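(* Let $q$ be a power of an odd prime and let $n$ be an odd positive integer. If $h_q(n)=0$, then $h_q(2n)=0$.
   Context: For a prime power $q$ and $n\in\mathbb{N}$, let $e_0,\dots,e_{n-1}$ be the standard basis of $\mathbb{F}_q^n$ (indices mod $n$) and let $\tau:\mathbb{F}_q^n\to\mathbb{F}_q^n$ be the cyclic shift $\sum_i a_ie_i\mapsto\sum_i a_ie_{i+1}$. A subspace $U\subseteq\mathbb{F}_q^n$ is cyclically covering if $\bigcup_{i=0}^{n-1}\tau^i(U)=\mathbb{F}_q^n$. $h_q(n)$ denotes the largest codimension of a cyclically covering subspace of $\mathbb{F}_q^n$. *)

theory Defs
  imports "Jordan_Normal_Form.DL_Rank" "HOL-Computational_Algebra.Primes"
begin

text \<open>
  The field with \<open>q\<close> elements is a type \<open>'a :: {field, finite}\<close> with \<open>CARD('a) = q\<close>, and the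
  space of \<open>n\<close>-tuples over it is \<open>carrier_vec n\<close>, with vector space structure
  \<open>module_vec TYPE('a) n\<close>. All notions below are intended for \<open>n > 0\<close>.
\<close>

text \<open>The coefficient of \<open>e\<^sub>j\<close> in \<open>cyclic_shift v\<close> is that of \<open>e\<^sub>j\<^sub>-\<^sub>1\<close> in \<open>v\<close>;
  \<open>n - 1\<close> is added instead of subtracting 1 because of truncated subtraction on \<open>nat\<close>.\<close>

definition cyclic_shift :: "'a vec \<Rightarrow> 'a vec" where
  "cyclic_shift v = vec (dim_vec v) (\<lambda>j. v $ ((j + (dim_vec v - 1)) mod dim_vec v))"

definition cyclically_covering :: "nat \<Rightarrow> 'a :: field vec set \<Rightarrow> bool" where
  "cyclically_covering n U \<longleftrightarrow>
     subspace class_ring U (module_vec TYPE('a) n) \<and>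
     (\<Union>i<n. (cyclic_shift ^^ i) ` U) = carrier_vec n"

text \<open>\<open>V\<lparr>carrier := U\<rparr>\<close> is \<open>U\<close> as a vector space in its own right. The subtraction on \<open>nat\<close> does
  not truncate, since a subspace of a finite-dimensional space has smaller or equal dimension.\<close>

definition codimension :: "nat \<Rightarrow> 'a :: field vec set \<Rightarrow> nat" where
  "codimension n U =
     vectorspace.dim class_ring (module_vec TYPE('a) n) -
     vectorspace.dim class_ring ((module_vec TYPE('a) n)\<lparr>carrier := U\<rparr>)"

definition max_covering_codim :: "'a :: {field, finite} itself \<Rightarrow> nat \<Rightarrow> nat" where
  "max_covering_codim _ n = Max {codimension n U | U :: 'a vec set. cyclically_covering n U}"

lemma cyclic_shift_coeff:
  assumes "v \<in> carrier_vec n" and "i < n"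
  shows "cyclic_shift v $ ((i + 1) mod n) = v $ i"
proof -
  have n: "n > 0" using assms by simp
  have "((i + 1) mod n + (n - 1)) mod n = (i + 1 + (n - 1)) mod n"
    by (rule mod_add_left_eq)
  also have "\<dots> = i"
    using assms n by simp
  finally show ?thesis
    using assms n unfolding cyclic_shift_def by auto
qed

text \<open>The maximum is over a finite nonempty set, so it is a genuine maximum.\<close>

lemma finite_covering_codims:
  "finite {codimension n U | U :: 'a :: {field, finite} vec set. cyclically_covering n U}"
proof -
  have "{U :: 'a vec set. cyclically_covering n U} \<subseteq> Pow (carrier_vec n)"
    unfolding cyclically_covering_def subspace_def submodule_def by (auto simp: module_vec_simps)
  moreover have "finite (carrier_vec n :: 'a vec set)"
  proof (rule finite_subset)
    show "carrier_vec n \<subseteq> (vec_of_list :: 'a list \<Rightarrow> _) ` {xs. set xs \<subseteq> UNIV \<and> length xs = n}"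
    proof
      fix v :: "'a vec" assume "v \<in> carrier_vec n"
      then show "v \<in> vec_of_list ` {xs. set xs \<subseteq> UNIV \<and> length xs = n}"
        by (intro image_eqI[of _ _ "list_of_vec v"]) (auto simp: vec_list)
    qed
    show "finite ((vec_of_list :: 'a list \<Rightarrow> _) ` {xs. set xs \<subseteq> UNIV \<and> length xs = n})"
      by (intro finite_imageI finite_lists_length_eq) simp
  qed
  ultimately have "finite {U :: 'a vec set. cyclically_covering n U}"
    using finite_subset by blast
  then show ?thesis by (simp add: setcompr_eq_image)
qed

lemma cyclic_shift_carrier: "v \<in> carrier_vec n \<Longrightarrow> cyclic_shift v \<in> carrier_vec n"
  unfolding cyclic_shift_def by auto

lemma cyclically_covering_whole_space:
  assumes "n > 0"
  shows "cyclically_covering n (carrier_vec n :: 'a :: field vec set)"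
proof -
  interpret vec_space "TYPE('a)" n .
  have "(cyclic_shift ^^ i) v \<in> carrier_vec n" if "v \<in> carrier_vec n" for i and v :: "'a vec"
    using that by (induction i) (auto intro: cyclic_shift_carrier)
  moreover have "carrier_vec n \<subseteq> (\<Union>i<n. (cyclic_shift ^^ i) ` (carrier_vec n :: 'a vec set))"
    using assms by (auto intro!: bexI[of _ 0])
  moreover have "subspace class_ring (carrier_vec n) (module_vec TYPE('a) n)"
    unfolding subspace_def submodule_def
    using vec_vs vec_module by (auto simp: vectorspace_def)
  ultimately show ?thesis unfolding cyclically_covering_def by auto
qed

end

theory Submission
  imports Defs
begin

text \<open>
  Let \<open>U\<close> be a cyclically covering subspace of \<open>F\<^bsup>2n\<^esup>\<close>. Concatenating \<open>v\<close> with itself commutes with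
  the cyclic shift, so the vectors \<open>v\<close> in \<open>F\<^sup>n\<close> whose double lies in \<open>U\<close> form a cyclically covering
  subspace of \<open>F\<^sup>n\<close>, which must be all of \<open>F\<^sup>n\<close>. The same holds for the double with alternating
  signs, which for odd \<open>n\<close> has the form \<open>(v', - v')\<close> with \<open>v'\<^sub>j = (- 1)\<^sup>j v\<^sub>j\<close> and commutes with the shift up to sign. As 2 is
  invertible, the vectors of both kinds span \<open>F\<^bsup>2n\<^esup>\<close>.
\<close>

section \<open>Subspaces of full dimension and vanishing codimension\<close>

text \<open>A basis of \<open>X\<close> stays linearly independent in \<open>V\<close> and has at
  least \<open>dim\<close> elements, so it is a basis of \<open>V\<close> too, and both spaces are
  its span.\<close>

lemma (in vectorspace) subspace_eq_carrier:
  assumes X: "subspace K X V" and fd: "fin_dim" "vectorspace.fin_dim K (vs X)"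
    and dim: "dim \<le> vectorspace.dim K (vs X)"
  shows "X = carrier V"
proof -
  interpret X: vectorspace K "vs X" using X by (rule subspace_is_vs)
  have sub: "submodule K X V" using X by (simp add: subspace_def)
  obtain b where b: "finite b" "X.basis b" using X.finite_basis_exists[OF fd(2)] by blast
  have bX: "b \<subseteq> X" using b(2) by (simp add: X.basis_def)
  have XV: "X \<subseteq> carrier V" using sub by (simp add: submodule_def)
  have "lin_indpt b"
    using b(2) span_li_not_depend(2)[OF bX sub] by (simp add: X.basis_def)
  moreover have "dim \<le> card b" using dim X.dim_basis[OF b] by simp
  ultimately have "basis b"
    using dim_li_is_basis[OF fd(1) b(1)] bX XV by blast
  then have "span b = carrier V" by (simp add: basis_def)
  moreover have "span b = X"
    using b(2) span_li_not_depend(1)[OF bX sub] by (simp add: X.basis_def)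
  ultimately show ?thesis by simp
qed

lemma finite_carrier_vec: "finite (carrier_vec n :: 'a :: finite vec set)"
proof (rule finite_imageD)
  have "list_of_vec ` (carrier_vec n :: 'a vec set) \<subseteq> {xs. set xs \<subseteq> UNIV \<and> length xs = n}"
    by auto
  then show "finite (list_of_vec ` (carrier_vec n :: 'a vec set))"
    by (rule finite_subset) (intro finite_lists_length_eq finite)
qed (intro inj_on_inverseI[of _ vec_of_list] vec_list)

lemma subspace_vec_iff:
  "subspace class_ring U (module_vec TYPE('a :: field) n) \<longleftrightarrow>
    U \<subseteq> carrier_vec n \<and> 0\<^sub>v n \<in> U \<and> (\<forall>u\<in>U. \<forall>v\<in>U. u + v \<in> U) \<and> (\<forall>c. \<forall>u\<in>U. c \<cdot>\<^sub>v u \<in> U)"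
proof -
  interpret vec_space "TYPE('a)" n .
  show ?thesis
    unfolding subspace_def submodule_def
    using vec_vs vec_module by (auto simp: module_vec_simps class_ring_simps)
qed

lemma codimension_eq_0_iff:
  fixes U :: "'a :: {field, finite} vec set"
  assumes U: "subspace class_ring U (module_vec TYPE('a) n)"
  shows "codimension n U = 0 \<longleftrightarrow> U = carrier_vec n"
proof
  interpret vec_space "TYPE('a)" n .
  interpret U: vectorspace class_ring "vs U" using U by (rule subspace_is_vs)
  have sub: "U \<subseteq> carrier_vec n" using U by (simp add: subspace_vec_iff)
  have "finite U" using finite_carrier_vec sub by (rule finite_subset[rotated])
  \<comment> \<open>Being finite, \<open>U\<close> serves as its own finite generating set.\<close>
  then have "U.fin_dim"
    unfolding U.fin_dim_def
    using U.in_own_span[of U] U.span_is_subset2[of U] by (auto intro!: exI[of _ U])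
  \<comment> \<open>With subtraction on naturals, a zero difference yields just the inequality of
    dimensions that \<open>subspace_eq_carrier\<close> asks for.\<close>
  then show "U = carrier_vec n" if "codimension n U = 0"
    using subspace_eq_carrier[OF U fin_dim] that unfolding codimension_def by simp
  show "codimension n U = 0" if "U = carrier_vec n"
  proof -
    have "V\<lparr>carrier := U\<rparr> = V" using that by (simp add: module_vec_def)
    then show ?thesis by (simp add: codimension_def)
  qed
qed

lemma max_covering_codim_eq_0_iff:
  assumes "n > 0"
  shows "max_covering_codim TYPE('a :: {field, finite}) n = 0 \<longleftrightarrow>
    (\<forall>U :: 'a vec set. cyclically_covering n U \<longrightarrow> U = carrier_vec n)"
proof -
  let ?cov = "{U :: 'a vec set. cyclically_covering n U}"
  have codims: "{codimension n U | U :: 'a vec set. cyclically_covering n U} = codimension n ` ?cov"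
    by (rule setcompr_eq_image)
  have fin: "finite (codimension n ` ?cov)"
    using finite_covering_codims[where 'a = 'a, of n] unfolding codims .
  have ne: "codimension n ` ?cov \<noteq> {}"
    using cyclically_covering_whole_space[OF assms] by auto
  have "Max (codimension n ` ?cov) = 0 \<longleftrightarrow> Max (codimension n ` ?cov) \<le> 0"
    by (rule le_zero_eq[symmetric])
  also have "\<dots> \<longleftrightarrow> (\<forall>U\<in>?cov. codimension n U = 0)"
    unfolding Max_le_iff[OF fin ne] by simp
  also have "\<dots> \<longleftrightarrow> (\<forall>U\<in>?cov. U = carrier_vec n)"
    by (intro ball_cong refl codimension_eq_0_iff) (simp add: cyclically_covering_def)
  finally show ?thesis
    by (simp only: max_covering_codim_def codims ball_simps mem_Collect_eq)
qed

section \<open>Powers of the cyclic shift\<close>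

lemma dim_cyclic_shift [simp]: "dim_vec (cyclic_shift v) = dim_vec v"
  by (simp add: cyclic_shift_def)

lemma dim_cyclic_shift_funpow [simp]: "dim_vec ((cyclic_shift ^^ i) v) = dim_vec v"
  by (induction i) auto

lemma cyclic_shift_smult: "cyclic_shift (c \<cdot>\<^sub>v v) = c \<cdot>\<^sub>v cyclic_shift v"
  by (rule eq_vecI) (auto simp: cyclic_shift_def)

lemma cyclic_shift_funpow_smult: "(cyclic_shift ^^ i) (c \<cdot>\<^sub>v v) = c \<cdot>\<^sub>v (cyclic_shift ^^ i) v"
  by (induction i) (auto simp: cyclic_shift_smult)

text \<open>Adding \<open>dim_vec v - 1\<close> is subtracting 1 modulo the dimension, so
  \<open>i\<close> shifts read \<open>i\<close> places back.\<close>

lemma cyclic_shift_funpow_coeff: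
  assumes "j < dim_vec v"
  shows "(cyclic_shift ^^ i) v $ j = v $ ((j + i * (dim_vec v - 1)) mod dim_vec v)"
  using assms
proof (induction i arbitrary: j)
  case (Suc i)
  define d where "d = dim_vec v"
  have "(cyclic_shift ^^ Suc i) v $ j = (cyclic_shift ^^ i) v $ ((j + (d - 1)) mod d)"
    using Suc.prems by (simp add: cyclic_shift_def d_def)
  also have "\<dots> = v $ (((j + (d - 1)) mod d + i * (d - 1)) mod d)"
    using Suc.prems unfolding d_def by (intro Suc.IH) auto
  finally show ?case by (simp add: d_def mod_add_left_eq flip: add.assoc)
qed simp

lemma cyclic_shift_funpow_dim: "(cyclic_shift ^^ dim_vec v) v = v"
  by (rule eq_vecI) (auto simp: cyclic_shift_funpow_coeff)

lemma cyclic_shift_funpow_mod: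
  assumes "v \<in> carrier_vec n"
  shows "(cyclic_shift ^^ (i mod n)) v = (cyclic_shift ^^ i) v"
  by (rule funpow_mod_eq) (use assms cyclic_shift_funpow_dim[of v] in simp)

text \<open>The shift has period \<open>n\<close>. The multiple \<open>n * i\<close> is at least
  \<open>i\<close>, so \<open>n * i - i\<close> is an untruncated representative of
  \<open>- i\<close> modulo \<open>n\<close>.\<close>

lemma cyclic_shift_funpow_inverse:
  assumes "v \<in> carrier_vec n" "n > 0"
  shows "(cyclic_shift ^^ i) ((cyclic_shift ^^ (n * i - i)) v) = v"
    and "(cyclic_shift ^^ (n * i - i)) ((cyclic_shift ^^ i) v) = v"
proof -
  have "i \<le> n * i" using assms(2) by simp
  moreover have "(cyclic_shift ^^ (n * i)) v = v"
    using cyclic_shift_funpow_mod[OF assms(1), of "n * i"] by simp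
  ultimately have "(cyclic_shift ^^ (i + (n * i - i))) v = v"
    "(cyclic_shift ^^ ((n * i - i) + i)) v = v"
    by simp_all
  then show "(cyclic_shift ^^ i) ((cyclic_shift ^^ (n * i - i)) v) = v"
    "(cyclic_shift ^^ (n * i - i)) ((cyclic_shift ^^ i) v) = v"
    by (simp_all only: funpow_add comp_apply)
qed

section \<open>Pulling back covering subspaces\<close>

text \<open>The factor \<open>c\<close> is harmless because the covering subspace is closed under scaling.\<close>

lemma cyclically_covering_vimage:
  fixes T :: "'a :: field vec \<Rightarrow> 'a vec"
  assumes cov: "cyclically_covering m U" and "n > 0"
    and T_carrier: "\<And>v. v \<in> carrier_vec n \<Longrightarrow> T v \<in> carrier_vec m"
    and T_add: "\<And>u v. u \<in> carrier_vec n \<Longrightarrow> v \<in> carrier_vec n \<Longrightarrow> T (u + v) = T u + T v"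
    and T_smult: "\<And>a v. v \<in> carrier_vec n \<Longrightarrow> T (a \<cdot>\<^sub>v v) = a \<cdot>\<^sub>v T v"
    and T_shift: "\<And>v. v \<in> carrier_vec n \<Longrightarrow> T (cyclic_shift v) = c \<cdot>\<^sub>v cyclic_shift (T v)"
    and c: "c \<noteq> 0"
  shows "cyclically_covering n {v \<in> carrier_vec n. T v \<in> U}"
proof -
  have U: "U \<subseteq> carrier_vec m" "0\<^sub>v m \<in> U" "\<And>u v. u \<in> U \<Longrightarrow> v \<in> U \<Longrightarrow> u + v \<in> U"
      "\<And>a u. u \<in> U \<Longrightarrow> a \<cdot>\<^sub>v u \<in> U"
    and cover: "(\<Union>i<m. (cyclic_shift ^^ i) ` U) = carrier_vec m"
    using cov by (auto simp: cyclically_covering_def subspace_vec_iff)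
  have funpow_carrier: "(cyclic_shift ^^ i) v \<in> carrier_vec n"
    if "v \<in> carrier_vec n" for i and v :: "'a vec"
    using that by (intro carrier_vecI) simp
  have T_zero: "T (0\<^sub>v n) = 0\<^sub>v m"
  proof -
    have "0 \<cdot>\<^sub>v u = 0\<^sub>v k" if "u \<in> carrier_vec k" for u :: "'a vec" and k
      using that by (intro eq_vecI) auto
    then show ?thesis
      using T_smult[of "0\<^sub>v n" 0] T_carrier[of "0\<^sub>v n"] by (metis zero_carrier_vec)
  qed
  have T_funpow: "T ((cyclic_shift ^^ i) v) = c ^ i \<cdot>\<^sub>v (cyclic_shift ^^ i) (T v)"
    if v: "v \<in> carrier_vec n" for i v
  proof (induction i)
    case (Suc i)
    then show ?case
      using T_shift[OF funpow_carrier[OF v, of i]]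
      by (simp add: cyclic_shift_smult smult_smult_assoc)
  qed simp
  have "v \<in> (\<Union>i<n. (cyclic_shift ^^ i) ` {v \<in> carrier_vec n. T v \<in> U})"
    if v: "v \<in> carrier_vec n" for v
  proof -
    obtain i u where i: "i < m" and u: "u \<in> U" "T v = (cyclic_shift ^^ i) u"
      using T_carrier[OF v] cover by blast
    \<comment> \<open>Shift \<open>v\<close> back by the amount that \<open>T v\<close> is shifted
      from \<open>u\<close>: then \<open>T v'\<close> is \<open>u\<close> up to the factor
      \<open>c ^ i\<close>.\<close>
    define v' where "v' = (cyclic_shift ^^ (n * i - i)) v"
    have v': "v' \<in> carrier_vec n" using v by (simp add: v'_def funpow_carrier)
    have shift_v': "(cyclic_shift ^^ i) v' = v"
      unfolding v'_def using v \<open>n > 0\<close> by (rule cyclic_shift_funpow_inverse)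
    have "(cyclic_shift ^^ i) (c ^ i \<cdot>\<^sub>v T v') = (cyclic_shift ^^ i) u"
      using T_funpow[OF v', of i] u(2) by (simp add: shift_v' cyclic_shift_funpow_smult)
    moreover have "inj_on (cyclic_shift ^^ i) (carrier_vec m :: 'a vec set)"
      using i by (intro inj_on_inverseI[of _ "cyclic_shift ^^ (m * i - i)"]
        cyclic_shift_funpow_inverse) auto
    moreover have "c ^ i \<cdot>\<^sub>v T v' \<in> carrier_vec m" "u \<in> carrier_vec m"
      using T_carrier[OF v'] u(1) U(1) by auto
    ultimately have "c ^ i \<cdot>\<^sub>v T v' = u" by (metis inj_onD)
    then have "inverse (c ^ i) \<cdot>\<^sub>v (c ^ i \<cdot>\<^sub>v T v') \<in> U" using U(4) u(1) by simp
    then have "T v' \<in> U" using c by (simp add: smult_smult_assoc)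
    \<comment> \<open>The index \<open>i\<close> is bounded by \<open>m\<close> and may exceed
      \<open>n\<close>; periodicity brings it below \<open>n\<close>.\<close>
    moreover have "v = (cyclic_shift ^^ (i mod n)) v'"
      using shift_v' cyclic_shift_funpow_mod[OF v'] by simp
    ultimately show ?thesis using v' \<open>n > 0\<close> by (intro UN_I[of "i mod n"]) auto
  qed
  then show ?thesis
    unfolding cyclically_covering_def subspace_vec_iff
    using U T_zero T_add T_smult funpow_carrier by auto
qed

section \<open>The two twisted doubles\<close>

text \<open>With \<open>n = dim_vec v\<close> odd, \<open>s = 1\<close> embeds the polynomials modulo \<open>x\<^sup>n - 1\<close> as the multiples
  of \<open>x\<^sup>n + 1\<close> modulo \<open>x\<^bsup>2n\<^esup> - 1\<close>, and \<open>s = - 1\<close>, which also substitutes \<open>- x\<close> for \<open>x\<close>,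
  embeds them as the multiples of \<open>x\<^sup>n - 1\<close>.\<close>

definition twisted_double :: "'a :: field \<Rightarrow> 'a vec \<Rightarrow> 'a vec" where
  "twisted_double s v = vec (2 * dim_vec v) (\<lambda>j. s ^ j * v $ (j mod dim_vec v))"

lemma twisted_double_cyclic_shift:
  assumes "s\<^sup>2 = 1"
  shows "twisted_double s (cyclic_shift v) = s \<cdot>\<^sub>v cyclic_shift (twisted_double s v)"
proof (rule eq_vecI)
  fix j assume j: "j < dim_vec (s \<cdot>\<^sub>v cyclic_shift (twisted_double s v))"
  define d where "d = dim_vec v"
  have d: "j < 2 * d" "d > 0" using j by (auto simp: twisted_double_def d_def)
  \<comment> \<open>The index that the shift of length \<open>2 * d\<close> reads at
    \<open>j\<close>. As \<open>d\<close> divides \<open>2 * d\<close>, its residue modulo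
    \<open>d\<close> is what the shift of length \<open>d\<close> reads at
    \<open>j mod d\<close>.\<close>
  define k where "k = (j + (2 * d - 1)) mod (2 * d)"
  have "k < 2 * d" using d by (simp add: k_def)
  have "k mod d = (j + (2 * d - 1)) mod d" by (simp add: k_def mod_mod_cancel)
  also have "\<dots> = (j + (d - 1) + d) mod d" by (rule arg_cong[where f = "\<lambda>a. a mod d"]) (use d in simp)
  also have "\<dots> = (j mod d + (d - 1)) mod d" by (simp add: mod_add_left_eq)
  finally have k_mod: "k mod d = (j mod d + (d - 1)) mod d" .
  \<comment> \<open>The exponent drops by one, except at \<open>j = 0\<close>, where it wraps to
    \<open>2 * d - 1\<close> and \<open>s ^ (2 * d) = 1\<close> closes the cycle.\<close>
  have "s * s ^ k = s ^ j"
  proof (cases "j = 0")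
    case True
    then have "Suc k = 2 * d" using d by (simp add: k_def)
    then show ?thesis
      using True assms by (metis power_0 power_Suc power_mult power_one)
  next
    case False
    then have "k = j - 1" using d by (simp add: k_def mod_if)
    then show ?thesis using False by (simp flip: power_Suc)
  qed
  then have "s * twisted_double s v $ k = s ^ j * v $ ((j mod d + (d - 1)) mod d)"
    using \<open>k < 2 * d\<close> k_mod
    by (simp add: twisted_double_def d_def[symmetric] mult.assoc[symmetric])
  moreover have "(s \<cdot>\<^sub>v cyclic_shift (twisted_double s v)) $ j = s * twisted_double s v $ k"
    using d by (simp add: cyclic_shift_def twisted_double_def d_def k_def)
  moreover have "twisted_double s (cyclic_shift v) $ j = s ^ j * v $ ((j mod d + (d - 1)) mod d)"
    using d by (simp add: cyclic_shift_def twisted_double_def d_def)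
  ultimately show "twisted_double s (cyclic_shift v) $ j =
    (s \<cdot>\<^sub>v cyclic_shift (twisted_double s v)) $ j"
    by simp
qed (simp add: twisted_double_def)

lemma cyclically_covering_twisted_double:
  assumes "cyclically_covering (2 * n) U" "n > 0" "s\<^sup>2 = 1"
  shows "cyclically_covering n {v \<in> carrier_vec n. twisted_double s v \<in> U}"
proof (rule cyclically_covering_vimage[OF assms(1,2), where c = s])
  show "s \<noteq> 0" using assms(3) by auto
  show "twisted_double s (cyclic_shift v) = s \<cdot>\<^sub>v cyclic_shift (twisted_double s v)" for v
    using assms(3) by (rule twisted_double_cyclic_shift)
  show "twisted_double s (u + v) = twisted_double s u + twisted_double s v"
    if "u \<in> carrier_vec n" "v \<in> carrier_vec n" for u v
    using that by (intro eq_vecI) (auto simp: twisted_double_def distrib_left)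
  show "twisted_double s (a \<cdot>\<^sub>v v) = a \<cdot>\<^sub>v twisted_double s v" if "v \<in> carrier_vec n" for a v
    using that by (intro eq_vecI) (auto simp: twisted_double_def)
qed (auto simp: twisted_double_def)

lemma twisted_double_decomposition:
  fixes w :: "'a :: field vec"
  assumes w: "w \<in> carrier_vec (2 * n)" and "odd n" and two: "(2 :: 'a) \<noteq> 0"
  obtains u v where "u \<in> carrier_vec n" "v \<in> carrier_vec n"
    "w = twisted_double 1 u + twisted_double (- 1) v"
proof
  \<comment> \<open>Half the sum and half the difference of the two halves of \<open>w\<close>; the
    sign in \<open>?v\<close> cancels the twist.\<close>
  let ?u = "vec n (\<lambda>j. (w $ j + w $ (j + n)) / 2)"
  let ?v = "vec n (\<lambda>j. (- 1) ^ j * (w $ j - w $ (j + n)) / 2)"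
  have half: "(x + y) / 2 + (x - y) / 2 = x" "(x + y) / 2 - (x - y) / 2 = y" "(x + y) / 2 + (y - x) / 2 = y" for x y :: 'a
    using two by (simp_all add: add_divide_distrib[symmetric] diff_divide_distrib[symmetric])
  have sq: "(- 1) ^ j * ((- 1) ^ j * x / 2) = x / (2 :: 'a)" for j x
    by (cases "even j") auto
  show "w = twisted_double 1 ?u + twisted_double (- 1) ?v"
  proof (rule eq_vecI)
    fix j assume "j < dim_vec (twisted_double 1 ?u + twisted_double (- 1) ?v)"
    \<comment> \<open>In the second half, oddness of \<open>n\<close> gives
      \<open>(- 1) ^ (i + n) = - ((- 1) ^ i)\<close>, so the difference enters negatively.\<close>
    then have "j < n \<or> (\<exists>i<n. j = i + n)"
      by (auto simp: twisted_double_def) presburger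
    then show "w $ j = (twisted_double 1 ?u + twisted_double (- 1) ?v) $ j"
      using half sq \<open>odd n\<close> by (auto simp: twisted_double_def power_add)
  qed (use w in \<open>simp add: twisted_double_def\<close>)
qed auto

section \<open>Odd characteristic and the conclusion\<close>

text \<open>Translation by 1 permutes the ring, so adding 1 to every element leaves the sum of all
  elements unchanged.\<close>

lemma of_nat_card_UNIV_eq_0: "of_nat (card (UNIV :: 'a set)) = (0 :: 'a :: {ring_1, finite})"
proof -
  have "(\<Sum>x\<in>UNIV. x + 1) = (\<Sum>x\<in>UNIV. x :: 'a)"
    by (rule sum.reindex_bij_witness[of _ "\<lambda>x. x - 1" "\<lambda>x. x + 1"]) auto
  then show ?thesis by (simp add: sum.distrib)
qed

lemma two_neq_zero_if_odd_card:
  assumes "odd (card (UNIV :: 'a :: {field, finite} set))"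
  shows "(2 :: 'a) \<noteq> 0"
proof
  assume two: "(2 :: 'a) = 0"
  obtain m where "card (UNIV :: 'a set) = 2 * m + 1" using assms by (rule oddE)
  \<comment> \<open>If 2 vanished, this would read \<open>1 = 0\<close>.\<close>
  then have "(2 * of_nat m + 1 :: 'a) = 0"
    using of_nat_card_UNIV_eq_0[where 'a = 'a] by (simp add: add.commute)
  then show False using two by simp
qed

theorem theorem3p8:
  fixes p k q n :: nat
  assumes "prime p" and "odd p" and "k > 0" and "q = p ^ k"
    and "card (UNIV :: 'a :: {field, finite} set) = q"
    and "n > 0" and "odd n"
    and "max_covering_codim TYPE('a) n = 0"
  shows "max_covering_codim TYPE('a) (2 * n) = 0"
proof -
  have two: "(2 :: 'a) \<noteq> 0" using assms by (intro two_neq_zero_if_odd_card) simp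
  have "U = carrier_vec (2 * n)" if cov: "cyclically_covering (2 * n) U" for U :: "'a vec set"
  proof
    have U: "subspace class_ring U (module_vec TYPE('a) (2 * n))"
      using cov by (simp add: cyclically_covering_def)
    then show "U \<subseteq> carrier_vec (2 * n)" by (simp add: subspace_vec_iff)
    \<comment> \<open>The hypothesis on \<open>n\<close> forces the covering preimage of
      \<open>U\<close> to be all of \<open>carrier_vec n\<close>.\<close>
    have double: "twisted_double s v \<in> U" if "v \<in> carrier_vec n" "s\<^sup>2 = 1" for s v
      using cyclically_covering_twisted_double[OF cov \<open>n > 0\<close> that(2)] that(1) assms(8)
        max_covering_codim_eq_0_iff[OF \<open>n > 0\<close>, where 'a = 'a] by blast
    show "carrier_vec (2 * n) \<subseteq> U"
    proof
      fix w :: "'a vec" assume "w \<in> carrier_vec (2 * n)"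
      then obtain u v where uv: "u \<in> carrier_vec n" "v \<in> carrier_vec n"
        "w = twisted_double 1 u + twisted_double (- 1) v"
        using \<open>odd n\<close> two by (rule twisted_double_decomposition)
      then show "w \<in> U"
        using U double[of u 1] double[of v "- 1"] by (auto simp: subspace_vec_iff)
    qed
  qed
  then show ?thesis using \<open>n > 0\<close> by (simp add: max_covering_codim_eq_0_iff)
qed

end
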